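(* Let $V\subseteq[0,1]$ be a truth value set. If $V$ is countably infinite, then the prenex fragment of the Gödel logic $\mathbf{G}_V$ is not axiomatizable.
   Context: A truth value set is a set $V\subseteq[0,1]$ that is closed in $\mathbb{R}$ and contains $0$ and $1$. The language $L$ is a standard first-order language with variables, constants, function symbols, predicate symbols (as usual, countably infinitely many of each kind and arity, effectively coded), the predicate constant $\bot$, connectives $\land,\lor,\to$ and quantifiers $\exists,\forall$ (no equality); $\neg A$ abbreviates $A\to\bot$. An interpretation $\mathfrak{I}=\langle D,\mathbf{s}\rangle$ based on $V$ consists of a nonempty domain $D$ and a valuation $\mathbf{s}$ mapping $n$-ary predicate symbols to functions $D^n\to V$, with $\mathbf{s}(\bot)=0$, $n$-ary function symbols to functions $D^n\to D$, and constants and variables to elements of $D$; $L^{\mathfrak I}$ is $L$ extended by a constant for each $d\in D$, with $\mathbf{s}(d)=d$. $\mathbf{s}$ extends to terms as usual. Formulas of $L^{\mathfrak I}$ are evaluated by: $\mathfrak{I}(P(t_1,\ldots,t_n))=\mathbf{s}(P)(\mathbf{s}(t_1),\ldots,\mathbf{s}(t_n))$; $\mathfrak{I}(A\land B)=\min(\mathfrak{I}(A),\mathfrak{I}(B))$; $\mathfrak{I}(A\lor B)=\max(\mathfrak{I}(A),\mathfrak{I}(B))$; $\mathfrak{I}(A\to B)=\mathfrak{I}(B)$ if $\mathfrak{I}(A)>\mathfrak{I}(B)$ and $=1$ otherwise; $\mathfrak{I}(\forall x\,A(x))=\inf\{\mathfrak{I}(A(d)):d\in D\}$; $\mathfrak{I}(\exists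 x\,A(x))=\sup\{\mathfrak{I}(A(d)):d\in D\}$. The Gödel logic $\mathbf{G}_V$ is the set of formulas $A$ of $L$ such that $\mathfrak{I}(A)=1$ for every interpretation $\mathfrak{I}$ based on $V$. A formula is prenex if it has the form $\mathsf{Q}_1x_1\ldots\mathsf{Q}_nx_n\,B$ with $\mathsf{Q}_i\in\{\forall,\exists\}$ and $B$ quantifier-free. The prenex fragment of $\mathbf{G}_V$ is the set of prenex formulas belonging to $\mathbf{G}_V$. A set of formulas is called axiomatizable if it is recursively enumerable. *)

theory Defs
  imports Complex_Main "HOL-Library.Countable_Set"
begin

section \<open>Syntax\<close>

text \<open>The symbol written as index \<open>k\<close> applied to a list of length \<open>n\<close> is the \<open>k\<close>-th
  symbol of arity \<open>n\<close>; so there are countably many symbols of every arity, and the same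
  index with two different arities gives two different symbols. Constants are the
  function symbols of arity 0.\<close>

datatype tm = Var nat | Fn nat "tm list"

datatype fm =
    Bot
  | Pred nat "tm list"
  | And fm fm
  | Or fm fm
  | Imp fm fm
  | All nat fm
  | Ex nat fm

primrec qfree :: "fm \<Rightarrow> bool" where
  "qfree Bot \<longleftrightarrow> True"
| "qfree (Pred p ts) \<longleftrightarrow> True"
| "qfree (And A B) \<longleftrightarrow> qfree A \<and> qfree B"
| "qfree (Or A B) \<longleftrightarrow> qfree A \<and> qfree B"
| "qfree (Imp A B) \<longleftrightarrow> qfree A \<and> qfree B"
| "qfree (All x A) \<longleftrightarrow> False"
| "qfree (Ex x A) \<longleftrightarrow> False"

inductive prenex :: "fm \<Rightarrow> bool" where
  matrix: "qfree B \<Longrightarrow> prenex B"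
| all: "prenex A \<Longrightarrow> prenex (All x A)"
| ex: "prenex A \<Longrightarrow> prenex (Ex x A)"


section \<open>Semantics\<close>

definition truth_value_set :: "real set \<Rightarrow> bool" where
  "truth_value_set V \<longleftrightarrow> V \<subseteq> {0..1} \<and> closed V \<and> 0 \<in> V \<and> 1 \<in> V"

record 'u interp =
  domain :: "'u set"
  fint :: "nat \<Rightarrow> 'u list \<Rightarrow> 'u"
  pint :: "nat \<Rightarrow> 'u list \<Rightarrow> real"
  vint :: "nat \<Rightarrow> 'u"

text \<open>The functions in an interpretation are total on the ambient type; only their values
  on the domain \<open>domain I\<close> matter.\<close>

definition based_on :: "real set \<Rightarrow> 'u interp \<Rightarrow> bool" where
  "based_on V I \<longleftrightarrow>
     domain I \<noteq> {} \<and>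
     (\<forall>f. \<forall>ds \<in> lists (domain I). fint I f ds \<in> domain I) \<and>
     (\<forall>p. \<forall>ds \<in> lists (domain I). pint I p ds \<in> V) \<and>
     (\<forall>x. vint I x \<in> domain I)"

primrec tval :: "'u interp \<Rightarrow> tm \<Rightarrow> 'u" where
  "tval I (Var x) = vint I x"
| "tval I (Fn f ts) = fint I f (map (tval I) ts)"

text \<open>Instead of substituting a name for \<open>d\<close> into \<open>A(x)\<close>, the variable \<open>x\<close> is
  reinterpreted as \<open>d\<close>.\<close>

primrec fval :: "'u interp \<Rightarrow> fm \<Rightarrow> real" where
  "fval I Bot = 0"
| "fval I (Pred p ts) = pint I p (map (tval I) ts)"
| "fval I (And A B) = min (fval I A) (fval I B)"
| "fval I (Or A B) = max (fval I A) (fval I B)"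
| "fval I (Imp A B) = (if fval I A > fval I B then fval I B else 1)"
| "fval I (All x A) = (INF d \<in> domain I. fval (I\<lparr>vint := (vint I)(x := d)\<rparr>) A)"
| "fval I (Ex x A) = (SUP d \<in> domain I. fval (I\<lparr>vint := (vint I)(x := d)\<rparr>) A)"

text \<open>HOL cannot quantify over all types inside a definition, so the domains range over the
  nonempty subsets of a type \<open>'u\<close>. The choice of \<open>'u\<close> is immaterial as long as it is
  infinite, see the lemma \<open>goedel_logic_sound\<close> below.\<close>

definition goedel_logic :: "'u itself \<Rightarrow> real set \<Rightarrow> fm set" where
  "goedel_logic U V = {A. \<forall>I :: 'u interp. based_on V I \<longrightarrow> fval I A = 1}"

definition prenex_fragment :: "'u itself \<Rightarrow> real set \<Rightarrow> fm set" where
  "prenex_fragment U V = {A \<in> goedel_logic U V. prenex A}"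


section \<open>Recursive enumerability\<close>

text \<open>Programs for the partial recursive functions: zero, successor, projections,
  composition, primitive recursion, minimisation. \<open>computes r xs y\<close> says that \<open>r\<close> halts on
  input \<open>xs\<close> with output \<open>y\<close>.\<close>

datatype recf =
    Zero
  | Succ
  | Proj nat
  | Comp recf "recf list"
  | PrimRec recf recf
  | Mu recf

inductive computes :: "recf \<Rightarrow> nat list \<Rightarrow> nat \<Rightarrow> bool" where
  zero: "computes Zero xs 0"
| succ: "computes Succ [n] (Suc n)"
| proj: "i < length xs \<Longrightarrow> computes (Proj i) xs (xs ! i)"
| comp: "list_all2 (\<lambda>g. computes g xs) gs ys \<Longrightarrow> computes f ys z \<Longrightarrow>
    computes (Comp f gs) xs z"
| rec_0: "computes f xs y \<Longrightarrow> computes (PrimRec f g) (0 # xs) y"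
| rec_Suc: "computes (PrimRec f g) (n # xs) r \<Longrightarrow> computes g (r # n # xs) y \<Longrightarrow>
    computes (PrimRec f g) (Suc n # xs) y"
| mu: "computes f (n # xs) 0 \<Longrightarrow> (\<forall>m<n. \<exists>k. computes f (m # xs) (Suc k)) \<Longrightarrow>
    computes (Mu f) xs n"

definition recursively_enumerable :: "nat set \<Rightarrow> bool" where
  "recursively_enumerable S \<longleftrightarrow> (\<exists>r. S = {n. \<exists>y. computes r [n] y})"

primrec tm_code :: "tm \<Rightarrow> nat" where
  "tm_code (Var x) = prod_encode (0, x)"
| "tm_code (Fn f ts) = prod_encode (1, prod_encode (f, list_encode (map tm_code ts)))"

primrec fm_code :: "fm \<Rightarrow> nat" where
  "fm_code Bot = prod_encode (0, 0)"
| "fm_code (Pred p ts) = prod_encode (1, prod_encode (p, list_encode (map tm_code ts)))"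
| "fm_code (And A B) = prod_encode (2, prod_encode (fm_code A, fm_code B))"
| "fm_code (Or A B) = prod_encode (3, prod_encode (fm_code A, fm_code B))"
| "fm_code (Imp A B) = prod_encode (4, prod_encode (fm_code A, fm_code B))"
| "fm_code (All x A) = prod_encode (5, prod_encode (x, fm_code A))"
| "fm_code (Ex x A) = prod_encode (6, prod_encode (x, fm_code A))"

definition axiomatizable :: "fm set \<Rightarrow> bool" where
  "axiomatizable S \<longleftrightarrow> recursively_enumerable (fm_code ` S)"


section \<open>Basic properties of these notions\<close>

lemma tm_code_inject: "tm_code s = tm_code t \<Longrightarrow> s = t"
proof (induction s arbitrary: t)
  case (Var x)
  then show ?case by (cases t) auto
next
  case (Fn f ts)
  show ?case
  proof (cases t)
    case (Var x)
    then show ?thesis using Fn.prems by simp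
  next
    case (Fn g us)
    then have "f = g" "map tm_code ts = map tm_code us"
      using Fn.prems inj_list_encode[of UNIV] by (auto dest: injD)
    moreover from this have "ts = us"
      using Fn.IH
    proof (induction ts arbitrary: us)
      case Nil
      then show ?case by simp
    next
      case (Cons a ts)
      then show ?case by (cases us) auto
    qed
    ultimately show ?thesis using Fn by simp
  qed
qed

lemma inj_tm_code: "inj tm_code"
  by (rule injI) (rule tm_code_inject)

lemma fm_code_inject: "fm_code A = fm_code B \<Longrightarrow> A = B"
proof (induction A arbitrary: B)
  case (Pred p ts)
  then show ?case
    using inj_tm_code inj_list_encode[of UNIV] by (cases B) (auto dest: injD simp: inj_map_eq_map)
qed (case_tac B; simp)+

lemma inj_fm_code: "inj fm_code"
  by (rule injI) (rule fm_code_inject)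

lemma computes_fun: "computes r xs y \<Longrightarrow> computes r xs z \<Longrightarrow> y = z"
proof (induction arbitrary: z rule: computes.induct)
  case (zero xs)
  then show ?case by (auto elim: computes.cases)
next
  case (succ n)
  then show ?case by (auto elim: computes.cases)
next
  case (proj i xs)
  then show ?case by (auto elim: computes.cases)
next
  case (comp xs gs ys f y)
  from comp.prems obtain ys' where ys': "list_all2 (\<lambda>g. computes g xs) gs ys'"
    and f: "computes f ys' z"
    by (auto elim: computes.cases)
  have "ys = ys'"
    using comp.IH(1) ys'
    by (auto simp: list_all2_conv_all_nth intro!: nth_equalityI)
  with comp.IH(2) f show ?case by simp
next
  case (rec_0 f xs y g)
  from rec_0.prems show ?case by cases (auto intro: rec_0.IH)
next
  case (rec_Suc f g n xs r y)
  from rec_Suc.prems show ?case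
    by cases (metis rec_Suc.IH)
next
  case (mu f n xs)
  from mu.prems have z: "computes f (z # xs) 0" "\<forall>m<z. \<exists>k. computes f (m # xs) (Suc k)"
    by (auto elim: computes.cases)
  from mu.IH z show ?case
    by (metis linorder_neqE_nat nat.distinct(1))
qed

lemma countable_fm: "countable (UNIV :: fm set)"
  using inj_fm_code by (rule countableI)

lemma tval_in: "based_on V I \<Longrightarrow> tval I t \<in> domain I"
  by (induction t) (auto simp: based_on_def image_subset_iff in_lists_conv_set)

lemma based_on_upd: "based_on V I \<Longrightarrow> d \<in> domain I \<Longrightarrow> based_on V (I\<lparr>vint := (vint I)(x := d)\<rparr>)"
  by (auto simp: based_on_def)

lemma fval_bounds:
  assumes "V \<subseteq> {0..1}" "based_on V I"
  shows "fval I A \<in> {0..1}"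
  using assms(2)
proof (induction A arbitrary: I)
  case (Pred p ts)
  then have "map (tval I) ts \<in> lists (domain I)"
    using tval_in by fastforce
  then have "pint I p (map (tval I) ts) \<in> V"
    using Pred by (simp add: based_on_def del: in_lists_conv_set)
  then show ?case
    using assms(1) by auto
next
  case (And A B)
  then show ?case by (auto simp: min_def)
next
  case (Or A B)
  then show ?case by (auto simp: max_def)
next
  case (All x A)
  let ?f = "\<lambda>d. fval (I\<lparr>vint := (vint I)(x := d)\<rparr>) A"
  have b: "?f d \<in> {0..1}" if "d \<in> domain I" for d
    using All.IH[OF based_on_upd[OF All.prems that]] .
  obtain d0 where "d0 \<in> domain I" using All.prems by (auto simp: based_on_def)
  then have "Inf (?f ` domain I) \<le> ?f d0" "0 \<le> Inf (?f ` domain I)"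
    using b by (auto intro!: cINF_lower cINF_greatest bdd_belowI2[of _ 0])
  then show ?case using b[OF \<open>d0 \<in> domain I\<close>] by simp
next
  case (Ex x A)
  let ?f = "\<lambda>d. fval (I\<lparr>vint := (vint I)(x := d)\<rparr>) A"
  have b: "?f d \<in> {0..1}" if "d \<in> domain I" for d
    using Ex.IH[OF based_on_upd[OF Ex.prems that]] .
  obtain d0 where "d0 \<in> domain I" using Ex.prems by (auto simp: based_on_def)
  then have "Sup (?f ` domain I) \<ge> ?f d0" "1 \<ge> Sup (?f ` domain I)"
    using b by (auto intro!: cSUP_upper cSUP_least bdd_aboveI2[of _ _ 1])
  then show ?case using b[OF \<open>d0 \<in> domain I\<close>] by simp
qed auto


subsection \<open>Independence of the ambient type (downward Loewenheim-Skolem)\<close>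

lemma countable_approx:
  fixes f :: "'a \<Rightarrow> real"
  shows "\<exists>W. countable W \<and> W \<subseteq> D \<and>
    (\<forall>d\<in>D. \<forall>e>0. (\<exists>w\<in>W. f w < f d + e) \<and> (\<exists>w\<in>W. f d - e < f w))"
proof -
  define lo where "lo q = (SOME d. d \<in> D \<and> f d < q)" for q
  define hi where "hi q = (SOME d. d \<in> D \<and> q < f d)" for q
  define W where "W = D \<inter> (lo ` \<rat> \<union> hi ` \<rat>)"
  have lo: "lo q \<in> D \<and> f (lo q) < q" if "d \<in> D" "f d < q" for d q
    unfolding lo_def by (rule someI[of _ d]) (use that in simp)
  have hi: "hi q \<in> D \<and> q < f (hi q)" if "d \<in> D" "q < f d" for d q
    unfolding hi_def by (rule someI[of _ d]) (use that in simp)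
  have "countable W" "W \<subseteq> D"
    by (auto simp: W_def countable_rat)
  moreover have "\<exists>w\<in>W. f w < f d + e" if d: "d \<in> D" "e > 0" for d and e :: real
  proof -
    obtain q where q: "q \<in> \<rat>" "f d < q" "q < f d + e"
      using Rats_dense_in_real[of "f d" "f d + e"] d(2) by force
    with lo[of d q] d show ?thesis by (force simp: W_def)
  qed
  moreover have "\<exists>w\<in>W. f d - e < f w" if d: "d \<in> D" "e > 0" for d and e :: real
  proof -
    obtain q where q: "q \<in> \<rat>" "f d - e < q" "q < f d"
      using Rats_dense_in_real[of "f d - e" "f d"] d(2) by force
    with hi[of d q] d show ?thesis by (force simp: W_def)
  qed
  ultimately show ?thesis by (intro exI[of _ W]) simp
qed

lemma approx_Inf_Sup:
  fixes f :: "'a \<Rightarrow> real"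
  assumes sub: "W \<subseteq> D'" "D' \<subseteq> D" and ne: "D' \<noteq> {}" and b: "\<And>d. d \<in> D \<Longrightarrow> f d \<in> {0..1}"
    and W: "\<forall>d\<in>D. \<forall>e>0. (\<exists>w\<in>W. f w < f d + e) \<and> (\<exists>w\<in>W. f d - e < f w)"
  shows "Inf (f ` D') = Inf (f ` D)" "Sup (f ` D') = Sup (f ` D)"
proof -
  have bb: "bdd_below (f ` D)" "bdd_above (f ` D)" "bdd_below (f ` D')" "bdd_above (f ` D')"
    using b sub by (auto intro!: bdd_belowI2[of _ 0] bdd_aboveI2[of _ _ 1])
  have "Inf (f ` D') \<le> f d" if "d \<in> D" for d
  proof (rule field_le_epsilon)
    fix e :: real assume "e > 0"
    with W that obtain w where w: "w \<in> W" "f w < f d + e" by blast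
    have "Inf (f ` D') \<le> f w" using w sub bb by (auto intro!: cINF_lower)
    with w show "Inf (f ` D') \<le> f d + e" by simp
  qed
  then show "Inf (f ` D') = Inf (f ` D)"
    using sub ne bb by (intro antisym cINF_superset_mono cINF_greatest) auto
  have "f d \<le> Sup (f ` D')" if "d \<in> D" for d
  proof (rule field_le_epsilon)
    fix e :: real assume "e > 0"
    with W that obtain w where w: "w \<in> W" "f d - e < f w" by blast
    have "f w \<le> Sup (f ` D')" using w sub bb by (auto intro!: cSUP_upper)
    with w show "f d \<le> Sup (f ` D') + e" by simp
  qed
  then show "Sup (f ` D') = Sup (f ` D)"
    using sub ne bb by (intro antisym cSUP_subset_mono cSUP_least) auto
qed

definition upds :: "'u interp \<Rightarrow> (nat \<times> 'u) list \<Rightarrow> 'u interp" where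
  "upds I us = I\<lparr>vint := foldr (\<lambda>(x, d) e. e(x := d)) us (vint I)\<rparr>"

lemma upds_simps [simp]:
  "domain (upds I us) = domain I" "fint (upds I us) = fint I" "pint (upds I us) = pint I"
  "upds I [] = I"
  "(upds I us)\<lparr>vint := (vint (upds I us))(x := d)\<rparr> = upds I ((x, d) # us)"
  by (auto simp: upds_def)

lemma fval_upds:
  "fval (upds I us) (All x A) = (INF d \<in> domain I. fval (upds I ((x, d) # us)) A)"
  "fval (upds I us) (Ex x A) = (SUP d \<in> domain I. fval (upds I ((x, d) # us)) A)"
  by (simp_all only: fval.simps upds_simps)

lemma domain_domain: "domain (I\<lparr>domain := D\<rparr>) = D"
  by simp

lemma upds_in: "us \<in> lists (UNIV \<times> D) \<Longrightarrow> range (vint I) \<subseteq> D \<Longrightarrow> vint (upds I us) x \<in> D"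
  by (induction us) (auto simp: upds_def)

lemma upds_domain: "(upds I us)\<lparr>domain := D\<rparr> = upds (I\<lparr>domain := D\<rparr>) us"
  by (simp add: upds_def)

lemma tval_domain [simp]: "tval (I\<lparr>domain := D\<rparr>) = tval I"
proof
  show "tval (I\<lparr>domain := D\<rparr>) t = tval I t" for t
    by (induction t) (auto intro: arg_cong[where f = "fint I _"])
qed

lemma countable_submodel:
  assumes V: "V \<subseteq> {0..1}" and I: "based_on V I"
  shows "\<exists>D. countable D \<and> based_on V (I\<lparr>domain := D\<rparr>) \<and> (\<forall>A. fval (I\<lparr>domain := D\<rparr>) A = fval I A)"
proof -
  define val where "val B x us d = fval (upds I ((x, d) # us)) B" for B x us d
  define approx where "approx B x us W \<longleftrightarrow> countable W \<and> W \<subseteq> domain I \<and>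
    (\<forall>d\<in>domain I. \<forall>e>0. (\<exists>w\<in>W. val B x us w < val B x us d + e) \<and>
      (\<exists>w\<in>W. val B x us d - e < val B x us w))" for B x us W
  define wit where "wit B x us = (SOME W. approx B x us W)" for B x us
  have wit: "approx B x us (wit B x us)" for B x us
    unfolding wit_def by (rule someI_ex) (unfold approx_def, rule countable_approx)
  define step where "step D = D \<union> (\<Union>f. fint I f ` lists D) \<union>
    (\<Union>B. \<Union>x. \<Union>us \<in> lists (UNIV \<times> D). wit B x us)" for D
  define stage where "stage n = (step ^^ n) (range (vint I))" for n
  define D where "D = (\<Union>n. stage n)"
  have stage_Suc: "stage (Suc n) = step (stage n)" for n
    by (simp add: stage_def)
  have "mono stage"
    by (rule mono_iff_le_Suc[THEN iffD2]) (auto simp: stage_Suc step_def)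
  have cstep: "countable (step E)" if "countable E" for E
    using that wit countable_fm unfolding step_def approx_def
    by (intro countable_Un countable_UN countable_image countable_lists countable_SIGMA) auto
  have "countable (stage n)" for n
    by (induction n) (auto simp: stage_Suc cstep, simp add: stage_def)
  then have cD: "countable D" by (auto simp: D_def)
  have sub: "stage n \<subseteq> domain I" for n
  proof (induction n)
    case 0
    then show ?case using I by (auto simp: stage_def based_on_def)
  next
    case (Suc n)
    have "fint I f ds \<in> domain I" if "ds \<in> lists (stage n)" for f ds
      using that I lists_mono[OF Suc] unfolding based_on_def by blast
    moreover have "wit B x us \<subseteq> domain I" for B x us
      using wit by (simp add: approx_def)
    ultimately show ?case
      using Suc unfolding stage_Suc step_def by blast
  qed
  then have DI: "D \<subseteq> domain I" by (auto simp: D_def)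
  have vD: "range (vint I) \<subseteq> D"
    unfolding D_def by (rule order_trans[OF _ UN_upper[of 0]]) (auto simp: stage_def)
  have fin: "\<exists>n. F \<subseteq> stage n" if "finite F" "F \<subseteq> D" for F
    using that
  proof (induction F)
    case empty
    then show ?case by simp
  next
    case (insert a F)
    then obtain n m where "F \<subseteq> stage n" "a \<in> stage m" by (auto simp: D_def)
    then have "insert a F \<subseteq> stage (max n m)"
      using monoD[OF \<open>mono stage\<close>, of n "max n m"] monoD[OF \<open>mono stage\<close>, of m "max n m"] by auto
    then show ?case ..
  qed
  have fD: "fint I f ds \<in> D" if ds: "ds \<in> lists D" for f ds
  proof -
    obtain n where "set ds \<subseteq> stage n" using fin[of "set ds"] ds by auto
    then have "fint I f ds \<in> stage (Suc n)" by (auto simp: stage_Suc step_def)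
    then show ?thesis by (auto simp: D_def)
  qed
  have wD: "wit B x us \<subseteq> D" if us: "us \<in> lists (UNIV \<times> D)" for B x us
  proof -
    have "snd ` set us \<subseteq> D" using us by force
    then obtain n where "snd ` set us \<subseteq> stage n" using fin[of "snd ` set us"] by auto
    then have "us \<in> lists (UNIV \<times> stage n)" by force
    then have "wit B x us \<subseteq> stage (Suc n)" by (auto simp: stage_Suc step_def)
    then show ?thesis by (auto simp: D_def)
  qed
  have DL: "ds \<in> lists (domain I)" if "ds \<in> lists D" for ds
    using that lists_mono[OF DI] by auto
  have bD: "based_on V (I\<lparr>domain := D\<rparr>)"
    using I vD fD DL by (auto simp: based_on_def)
  have upI: "based_on V (upds I us)" if "us \<in> lists (UNIV \<times> D)" for us
    using upds_in[OF that vD] I DI by (auto simp: based_on_def)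
  have eq: "fval (upds (I\<lparr>domain := D\<rparr>) us) A = fval (upds I us) A" if "us \<in> lists (UNIV \<times> D)" for us A
    using that
  proof (induction A arbitrary: us)
    case (Pred p ts)
    have "tval (upds (I\<lparr>domain := D\<rparr>) us) = tval (upds I us)"
      using tval_domain[of D "upds I us"] by (simp only: upds_domain)
    then show ?case by (simp only: fval.simps) simp
  next
    case (All x A)
    have "Inf (val A x us ` D) = Inf (val A x us ` domain I)"
    proof (rule approx_Inf_Sup(1)[OF wD[OF All.prems] DI])
      show "D \<noteq> {}" using vD by auto
      show "val A x us d \<in> {0..1}" if "d \<in> domain I" for d
        using fval_bounds[OF V based_on_upd[OF upI[OF All.prems]]] that
        unfolding val_def by simp
    qed (use wit[of A x us] in \<open>auto simp: approx_def\<close>)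
    moreover have "(\<lambda>d. fval (upds (I\<lparr>domain := D\<rparr>) ((x, d) # us)) A) ` D = val A x us ` D"
      unfolding val_def by (rule image_cong[OF refl], rule All.IH) (use All.prems in auto)
    ultimately show ?case
      by (simp only: fval_upds domain_domain) (simp only: val_def[abs_def])
  next
    case (Ex x A)
    have "Sup (val A x us ` D) = Sup (val A x us ` domain I)"
    proof (rule approx_Inf_Sup(2)[OF wD[OF Ex.prems] DI])
      show "D \<noteq> {}" using vD by auto
      show "val A x us d \<in> {0..1}" if "d \<in> domain I" for d
        using fval_bounds[OF V based_on_upd[OF upI[OF Ex.prems]]] that
        unfolding val_def by simp
    qed (use wit[of A x us] in \<open>auto simp: approx_def\<close>)
    moreover have "(\<lambda>d. fval (upds (I\<lparr>domain := D\<rparr>) ((x, d) # us)) A) ` D = val A x us ` D"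
      unfolding val_def by (rule image_cong[OF refl], rule Ex.IH) (use Ex.prems in auto)
    ultimately show ?case
      by (simp only: fval_upds domain_domain) (simp only: val_def[abs_def])
  qed auto
  have "fval (I\<lparr>domain := D\<rparr>) A = fval I A" for A
    using eq[of "[]" A] by simp
  with cD bD show ?thesis by blast
qed

text \<open>Transport of an interpretation along an injection \<open>h\<close> with left inverse \<open>g\<close> on its
  domain.\<close>

definition transport :: "('d \<Rightarrow> 'u) \<Rightarrow> ('u \<Rightarrow> 'd) \<Rightarrow> 'd interp \<Rightarrow> 'u interp" where
  "transport h g I = \<lparr>domain = h ` domain I, fint = (\<lambda>f ds. h (fint I f (map g ds))),
     pint = (\<lambda>p ds. pint I p (map g ds)), vint = h \<circ> vint I\<rparr>"

lemma transport_based_on: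
  assumes "based_on V I" "\<forall>d \<in> domain I. g (h d) = d"
  shows "based_on V (transport h g I)"
proof -
  have "map g ds \<in> lists (domain I)" if "ds \<in> lists (h ` domain I)" for ds
    using that assms(2) by (induction ds) auto
  then show ?thesis using assms(1) by (auto simp: based_on_def transport_def)
qed

lemma transport_tval:
  assumes "based_on V I" "\<forall>d \<in> domain I. g (h d) = d"
  shows "tval (transport h g I) t = h (tval I t)"
proof (induction t)
  case (Var x)
  then show ?case by (simp add: transport_def)
next
  case (Fn f ts)
  then have "map (g \<circ> tval (transport h g I)) ts = map (tval I) ts"
    using assms(2) tval_in[OF assms(1)] by simp
  moreover have "fint (transport h g I) f ds = h (fint I f (map g ds))" for ds
    by (simp add: transport_def)
  ultimately show ?case by (simp del: map_eq_conv)
qed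

lemma transport_fval:
  assumes "based_on V I" "\<forall>d \<in> domain I. g (h d) = d"
  shows "fval (transport h g I) A = fval I A"
  using assms
proof (induction A arbitrary: I)
  case (Pred p ts)
  have "map (g \<circ> tval (transport h g I)) ts = map (tval I) ts"
    using transport_tval[where g = g and h = h, OF Pred] Pred(2) tval_in[OF Pred(1)] by simp
  moreover have "pint (transport h g I) p ds = pint I p (map g ds)" for ds
    by (simp add: transport_def)
  ultimately show ?case by (simp del: map_eq_conv)
next
  case (All x A)
  have "fval ((transport h g I)\<lparr>vint := (vint (transport h g I))(x := h d)\<rparr>) A =
      fval (I\<lparr>vint := (vint I)(x := d)\<rparr>) A" if "d \<in> domain I" for d
  proof -
    have "(transport h g I)\<lparr>vint := (vint (transport h g I))(x := h d)\<rparr> =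
        transport h g (I\<lparr>vint := (vint I)(x := d)\<rparr>)"
      by (auto simp: transport_def)
    then show ?thesis
      using All.IH[OF based_on_upd[OF All.prems(1) that]] All.prems(2) by simp
  qed
  moreover have "domain (transport h g I) = h ` domain I" by (simp add: transport_def)
  ultimately show ?case by (simp add: image_image cong: image_cong_simp)
next
  case (Ex x A)
  have "fval ((transport h g I)\<lparr>vint := (vint (transport h g I))(x := h d)\<rparr>) A =
      fval (I\<lparr>vint := (vint I)(x := d)\<rparr>) A" if "d \<in> domain I" for d
  proof -
    have "(transport h g I)\<lparr>vint := (vint (transport h g I))(x := h d)\<rparr> =
        transport h g (I\<lparr>vint := (vint I)(x := d)\<rparr>)"
      by (auto simp: transport_def)
    then show ?thesis
      using Ex.IH[OF based_on_upd[OF Ex.prems(1) that]] Ex.prems(2) by simp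
  qed
  moreover have "domain (transport h g I) = h ` domain I" by (simp add: transport_def)
  ultimately show ?case by (simp add: image_image cong: image_cong_simp)
qed auto

text \<open>A formula valid over the subsets of one infinite type is valid over all domains,
  whatever their type.\<close>

theorem goedel_logic_sound:
  fixes I :: "'d interp"
  assumes "infinite (UNIV :: 'u set)" "truth_value_set V"
    and "A \<in> goedel_logic TYPE('u) V" "based_on V I"
  shows "fval I A = 1"
proof -
  obtain D where D: "countable D" "based_on V (I\<lparr>domain := D\<rparr>)" "fval (I\<lparr>domain := D\<rparr>) A = fval I A"
    using countable_submodel[of V I] assms by (auto simp: truth_value_set_def)
  obtain k :: "nat \<Rightarrow> 'u" where k: "inj k"
    using infinite_countable_subset[OF assms(1)] by auto
  define h where "h = k \<circ> to_nat_on D"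
  have "inj_on h D"
    unfolding h_def using k D(1) by (intro comp_inj_on) (auto intro: inj_on_subset)
  then have g: "\<forall>d \<in> domain (I\<lparr>domain := D\<rparr>). inv_into D h (h d) = d"
    by simp
  have "fval (transport h (inv_into D h) (I\<lparr>domain := D\<rparr>)) A = 1"
    using assms(3) transport_based_on[where h = h, OF D(2) g] by (simp add: goedel_logic_def)
  then show ?thesis
    using transport_fval[where h = h, OF D(2) g] D(3) by simp
qed

corollary goedel_logic_type_independent:
  assumes "infinite (UNIV :: 'u set)" "infinite (UNIV :: 'v set)" "truth_value_set V"
  shows "goedel_logic TYPE('u) V = goedel_logic TYPE('v) V"
  using goedel_logic_sound[OF assms(1,3)] goedel_logic_sound[OF assms(2,3)]
  unfolding goedel_logic_def by blast

end

theory Submission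
  imports Defs
begin

text \<open>A purely existential formula \<open>\<exists>x\<^sub>1\<dots>x\<^sub>k. B\<close> is refuted by an interpretation if and only
  if all instances of the matrix \<open>B\<close> are bounded by one truth value below 1. In this way the
  negation of a universal theory with function symbols, about crisp (doubly negated) atoms and
  about the strict order of truth values, is expressed. The theory used here bisects an interval
  of truth values once for every step of a computation. A terminating computation needs only
  finitely many truth values, so the formula is refuted over every infinite \<open>V\<close>; a computation
  running forever would embed a dense order into \<open>V\<close>, which nested intervals exclude for closed
  countable \<open>V\<close>. So validity of the formula expresses that the computation does not halt, and a
  diagonal argument finishes the proof. The argument of the diagonal program is the code of the
  term that represents the program, so that no enumeration of programs has to be
  computed.\<close>

section \<open>Term rewriting as a prenex formula\<close>

primrec subst :: "(nat \<Rightarrow> tm) \<Rightarrow> tm \<Rightarrow> tm" where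
  "subst e (Var x) = e x"
| "subst e (Fn f ts) = Fn f (map (subst e) ts)"

primrec tvars :: "tm \<Rightarrow> nat set" where
  "tvars (Var x) = {x}"
| "tvars (Fn f ts) = (\<Union>(set (map tvars ts)))"

text \<open>Rewriting happens at the root only: a machine configuration is one term, replaced as a
  whole, so the formula needs no congruence clauses.\<close>

definition rewrite_step :: "(tm \<times> tm) list \<Rightarrow> tm \<Rightarrow> tm \<Rightarrow> bool" where
  "rewrite_step R s t \<longleftrightarrow> (\<exists>(l, r) \<in> set R. \<exists>e. s = subst e l \<and> t = subst e r)"

primrec exs :: "nat \<Rightarrow> fm \<Rightarrow> fm" where
  "exs 0 B = B"
| "exs (Suc k) B = Ex k (exs k B)"

abbreviation Neg :: "fm \<Rightarrow> fm" where
  "Neg A \<equiv> Imp A Bot"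

text \<open>Symbols are told apart by index together with arity, here and for the machine terms
  below, so the reuse of small indices causes no clash.\<close>

abbreviation "pt_lo \<equiv> Fn 0 []"
abbreviation "pt_hi \<equiv> Fn 1 []"
abbreviation "pt_mid a b \<equiv> Fn 0 [a, b]"

abbreviation Run :: "tm \<Rightarrow> tm \<Rightarrow> tm \<Rightarrow> fm" where
  "Run a b c \<equiv> Pred 0 [a, b, c]"

abbreviation Val :: "tm \<Rightarrow> fm" where
  "Val a \<equiv> Pred 0 [a]"

text \<open>\<open>Neg\<close> takes only the values 0 and 1, hence so does this formula. A bound
  below 1 makes it 0: if \<open>Run\<close> is positive for \<open>l\<close>, then it is positive
  for \<open>r\<close> on both halves.\<close>

definition rule_fm :: "tm \<times> tm \<Rightarrow> fm" where
  "rule_fm = (\<lambda>(l, r). And (Neg (Neg (Run (Var 0) (Var 1) l)))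
     (Or (Neg (Run (Var 0) (pt_mid (Var 0) (Var 1)) r))
         (Neg (Run (pt_mid (Var 0) (Var 1)) (Var 1) r))))"

text \<open>The implication is below 1 only if \<open>Val (Var 0)\<close> is strictly smaller than
  \<open>Val (Var 1)\<close>, and then it has the value of \<open>Val (Var 0)\<close>. A
  countermodel must therefore also keep the left endpoints of running intervals uniformly below
  1.\<close>

definition order_fm :: fm where
  "order_fm = And (Neg (Neg (Run (Var 0) (Var 1) (Var 2)))) (Imp (Val (Var 1)) (Val (Var 0)))"

text \<open>The disjuncts are the negations of the constraints that a countermodel has to satisfy:
  \<open>Run(a, b, c)\<close> says that the interval from \<open>a\<close> to \<open>b\<close>, which must be proper in the sense that
  \<open>Val a < Val b\<close>, carries the term \<open>c\<close>; whenever \<open>c\<close> rewrites to \<open>c'\<close>, both halves of the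
  interval carry \<open>c'\<close>.\<close>

definition matrix_fm :: "(tm \<times> tm) list \<Rightarrow> tm \<Rightarrow> fm" where
  "matrix_fm R t = Or (Neg (Run pt_lo pt_hi t)) (foldr (\<lambda>lr. Or (rule_fm lr)) R order_fm)"

definition run_fm :: "nat \<Rightarrow> (tm \<times> tm) list \<Rightarrow> tm \<Rightarrow> fm" where
  "run_fm k R t = exs k (matrix_fm R t)"

lemma prenex_run_fm: "prenex (run_fm k R t)"
proof -
  have "qfree (foldr (\<lambda>lr. Or (rule_fm lr)) R order_fm)"
    by (induction R) (auto simp: order_fm_def rule_fm_def)
  then have "qfree (matrix_fm R t)"
    by (simp add: matrix_fm_def)
  then show ?thesis
    unfolding run_fm_def by (induction k) (auto intro: prenex.intros)
qed

section \<open>Substitution, assignments and blocks of existential quantifiers\<close>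

lemma subst_closed: "tvars t = {} \<Longrightarrow> subst e t = t"
  by (induction t) (auto intro: map_idI)

lemma tval_vint_cong:
  "(\<And>x. x \<in> tvars t \<Longrightarrow> e x = tval I (s x)) \<Longrightarrow> tval (I\<lparr>vint := e\<rparr>) t = tval I (subst s t)"
proof (induction t)
  case (Fn f ts)
  then have "map (tval (I\<lparr>vint := e\<rparr>)) ts = map (tval I \<circ> subst s) ts"
    by auto
  then show ?case by (simp del: map_eq_conv)
qed simp

lemma tval_Herbrand:
  assumes "fint I = Fn"
  shows "tval I t = subst (vint I) t"
proof (induction t)
  case (Fn f ts)
  then have "map (tval I) ts = map (subst (vint I)) ts" by auto
  then show ?case using assms by simp
qed simp

text \<open>Only the variables below \<open>k\<close> are bound, so \<open>e\<close> must agree with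
  \<open>vint I\<close> from \<open>k\<close> on. The outermost quantifier binds the largest of
  them, which the induction sets first.\<close>

lemma fval_exs_ge:
  assumes V: "V \<subseteq> {0..1}"
  shows "\<lbrakk>based_on V I; \<And>x. e x \<in> domain I; \<And>x. x \<ge> k \<Longrightarrow> e x = vint I x\<rbrakk> \<Longrightarrow>
    fval (I\<lparr>vint := e\<rparr>) B \<le> fval I (exs k B)"
proof (induction k arbitrary: I)
  case 0
  then have "e = vint I" by auto
  then show ?case by simp
next
  case (Suc k)
  let ?J = "\<lambda>d. I\<lparr>vint := (vint I)(k := d)\<rparr>"
  have J: "based_on V (?J d)" if "d \<in> domain I" for d
    using Suc.prems(1) that by (rule based_on_upd)
  have "fval ((?J (e k))\<lparr>vint := e\<rparr>) B \<le> fval (?J (e k)) (exs k B)"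
    by (rule Suc.IH[OF J]) (use Suc.prems in \<open>auto simp: not_less_eq_eq\<close>)
  also have "\<dots> \<le> (SUP d \<in> domain I. fval (?J d) (exs k B))"
    using Suc.prems(2) fval_bounds[OF V J] by (intro cSUP_upper bdd_aboveI2[of _ _ 1]) auto
  finally show ?case by simp
qed

text \<open>A supremum of values below 1 can be 1, so refuting the formula takes one bound
  \<open>v\<close> for all assignments.\<close>

lemma fval_exs_le:
  "\<lbrakk>based_on V I; \<And>e. range e \<subseteq> domain I \<Longrightarrow> fval (I\<lparr>vint := e\<rparr>) B \<le> v\<rbrakk> \<Longrightarrow>
    fval I (exs k B) \<le> v"
proof (induction k arbitrary: I)
  case 0
  have "range (vint I) \<subseteq> domain I" using 0 by (auto simp: based_on_def)
  then show ?case using "0.prems"(2)[of "vint I"] by simp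
next
  case (Suc k)
  have "fval (I\<lparr>vint := (vint I)(k := d)\<rparr>) (exs k B) \<le> v" if "d \<in> domain I" for d
    by (rule Suc.IH[OF based_on_upd[OF Suc.prems(1) that]]) (use Suc.prems(2) in simp)
  moreover have "domain I \<noteq> {}" using Suc.prems(1) by (simp add: based_on_def)
  ultimately show ?case by (auto intro: cSUP_least)
qed

lemma fval_disj_le_iff:
  "fval I (foldr (\<lambda>a. Or (f a)) xs B) \<le> v \<longleftrightarrow> (\<forall>a \<in> set xs. fval I (f a) \<le> v) \<and> fval I B \<le> v"
  by (induction xs) auto

text \<open>Nested intervals: stage \<open>k\<close> avoids the \<open>k\<close>-th element of
  \<open>V\<close>, yet the limit of the left endpoints lies in every interval and, \<open>V\<close>
  being closed, in \<open>V\<close>. \<open>Q k a b\<close> says that the interval is active at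
  level \<open>k\<close>.\<close>

lemma countable_closed_no_dense_bisection:
  fixes V :: "real set" and val :: "'d \<Rightarrow> real" and mid :: "'d \<Rightarrow> 'd \<Rightarrow> 'd"
  assumes V: "closed V" "countable V" and D: "\<And>a. a \<in> D \<Longrightarrow> val a \<in> V"
    and midD: "\<And>a b. a \<in> D \<Longrightarrow> b \<in> D \<Longrightarrow> mid a b \<in> D"
    and lt: "\<And>k a b. a \<in> D \<Longrightarrow> b \<in> D \<Longrightarrow> Q k a b \<Longrightarrow> val a < val b"
    and split: "\<And>k a b. a \<in> D \<Longrightarrow> b \<in> D \<Longrightarrow> Q k a b \<Longrightarrow> Q (Suc k) a (mid a b) \<and> Q (Suc k) (mid a b) b"
    and start: "a0 \<in> D" "b0 \<in> D" "Q (0::nat) a0 b0"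
  shows False
proof -
  define v where "v = from_nat_into V"
  have "V \<noteq> {}" using D start by auto
  then have V_eq: "V = range v"
    using V(2) by (simp add: v_def range_from_nat_into)
  \<comment> \<open>Two bisections per stage: if \<open>v k\<close> is at most the midpoint, the
    second one moves the left end strictly above \<open>v k\<close>; otherwise the midpoint, now the
    right end, is already below \<open>v k\<close>. Either way the level grows by 2.\<close>
  define refine where "refine k = (\<lambda>(a, b). if v k \<le> val (mid a b)
    then (mid (mid a b) b, b) else (mid a (mid a b), mid a b))" for k
  define J where "J = rec_nat (a0, b0) refine"
  have J: "J 0 = (a0, b0)" "J (Suc k) = refine k (J k)" for k
    by (simp_all add: J_def)
  define l u where "l k = fst (J k)" and "u k = snd (J k)" for k
  have inv: "l k \<in> D \<and> u k \<in> D \<and> Q (2 * k) (l k) (u k)" for k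
  proof (induction k)
    case 0
    then show ?case using start by (simp add: J l_def u_def)
  next
    case (Suc k)
    then show ?case
      using split midD by (auto simp: J refine_def l_def u_def split_beta)
  qed
  have ord: "val (l k) < val (l (Suc k)) \<and> val (l (Suc k)) < val (u (Suc k)) \<and>
      val (u (Suc k)) \<le> val (u k) \<and> \<not> (val (l (Suc k)) \<le> v k \<and> v k \<le> val (u (Suc k)))" for k
  proof -
    obtain a b where ab: "J k = (a, b)" by fastforce
    with inv[of k] have "a \<in> D" "b \<in> D" and Q: "Q (2 * k) a b" by (auto simp: l_def u_def)
    then have m: "mid a b \<in> D" using midD by blast
    note Q1 = split[OF \<open>a \<in> D\<close> \<open>b \<in> D\<close> Q]
    have "val a < val (mid a b)" "val (mid a b) < val b"
      using lt Q1 \<open>a \<in> D\<close> \<open>b \<in> D\<close> m by blast+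
    moreover have "val (mid a b) < val (mid (mid a b) b)" "val (mid (mid a b) b) < val b"
      "val a < val (mid a (mid a b))" "val (mid a (mid a b)) < val (mid a b)"
      using lt split Q1 \<open>a \<in> D\<close> \<open>b \<in> D\<close> m midD by meson+
    ultimately show ?thesis using ab by (simp add: J refine_def l_def u_def)
  qed
  have "incseq (\<lambda>k. val (l k))" "decseq (\<lambda>k. val (u k))"
    using ord by (auto intro: incseq_SucI decseq_SucI less_imp_le)
  have lu: "val (l j) \<le> val (u k)" for j k
  proof -
    have "val (l j) \<le> val (l (Suc (max j k)))"
      using \<open>incseq _\<close> by (rule incseqD) simp
    also have "\<dots> \<le> val (u (Suc (max j k)))" using ord by (simp add: less_imp_le)
    also have "\<dots> \<le> val (u k)" using \<open>decseq _\<close> by (rule decseqD) simp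
    finally show ?thesis .
  qed
  obtain s where s: "(\<lambda>k. val (l k)) \<longlonglongrightarrow> s" "\<And>k. val (l k) \<le> s"
    using incseq_convergent[OF \<open>incseq _\<close>, of "val (u 0)"] lu by metis
  have "s \<in> V"
    using closed_sequentially[OF V(1) _ s(1)] D inv by blast
  then obtain k where k: "s = v k" using V_eq by blast
  have "s \<le> val (u (Suc k))"
    using s(1) lu by (intro LIMSEQ_le_const2) auto
  with s(2)[of "Suc k"] ord[of k] k show False by blast
qed

text \<open>If the value were some \<open>v < 1\<close>, every instance of every disjunct would be
  at most \<open>v\<close>. Reading \<open>Run\<close> as true when positive, the infinite run
  \<open>c\<close> then keeps splitting intervals forever, which the preceding lemma
  forbids.\<close>

lemma run_fm_valid:
  assumes V: "truth_value_set V" "countable V"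
    and R: "\<And>l r. (l, r) \<in> set R \<Longrightarrow> tvars l \<union> tvars r \<subseteq> {2..<k}" and k: "k \<ge> 3"
    and run: "c 0 = t" "\<And>n. rewrite_step R (c n) (c (Suc n))"
    and I: "based_on V I"
  shows "fval I (run_fm k R t) = 1"
proof (rule ccontr)
  let ?D = "domain I"
  define v where "v = fval I (run_fm k R t)"
  assume "fval I (run_fm k R t) \<noteq> 1"
  have V01: "V \<subseteq> {0..1}" and clV: "closed V" using V by (auto simp: truth_value_set_def)
  with I \<open>fval I (run_fm k R t) \<noteq> 1\<close> have "v < 1"
    using fval_bounds[of V I "run_fm k R t"] by (auto simp: v_def)
  have vint: "vint I x \<in> ?D" for x
    using I by (simp add: based_on_def)
  \<comment> \<open>Variables 0 and 1 hold the endpoints, the other quantified ones the values under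
    a rewriting substitution.\<close>
  define asg where "asg a b s x =
    (if x = 0 then a else if x = 1 then b else if x < k then tval I (s x) else vint I x)"
    for a b s and x :: nat
  have le: "fval (I\<lparr>vint := asg a b s\<rparr>) (matrix_fm R t) \<le> v" if "a \<in> ?D" "b \<in> ?D" for a b s
    unfolding v_def run_fm_def using that k
    by (intro fval_exs_ge[OF V01 I]) (auto simp: asg_def vint tval_in[OF I])
  define val where "val a = pint I 0 [a]" for a
  define mid where "mid a b = fint I 0 [a, b]" for a b
  define Q where "Q n a b \<longleftrightarrow> pint I 0 [a, b, tval I (c n)] > 0" for n a b
  have valV: "val a \<in> V" if "a \<in> ?D" for a
    using I that by (simp add: based_on_def val_def)
  have run_ge: "pint I 0 [a, b, d] \<ge> 0" if "a \<in> ?D" "b \<in> ?D" "d \<in> ?D" for a b d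
  proof -
    have "pint I 0 [a, b, d] \<in> V" using I that by (simp add: based_on_def)
    then show ?thesis using V01 by auto
  qed
  have midD: "mid a b \<in> ?D" if "a \<in> ?D" "b \<in> ?D" for a b
    using I that by (simp add: based_on_def mid_def)
  have lt: "val a < val b" if "a \<in> ?D" "b \<in> ?D" "Q n a b" for n a b
  proof (rule ccontr)
    assume "\<not> val a < val b"
    \<comment> \<open>The constant substitution places \<open>c n\<close> in variable 2, which is
      quantified because \<open>k\<close> is at least 3.\<close>
    have "fval (I\<lparr>vint := asg a b (\<lambda>_. c n)\<rparr>) order_fm \<le> v"
      using le[OF that(1,2), of "\<lambda>_. c n"] by (simp add: matrix_fm_def fval_disj_le_iff)
    then show False
      using \<open>\<not> val a < val b\<close> that(3) k \<open>v < 1\<close>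
      by (simp add: order_fm_def asg_def val_def Q_def split: if_splits)
  qed
  have split: "Q (Suc n) a (mid a b) \<and> Q (Suc n) (mid a b) b"
    if "a \<in> ?D" "b \<in> ?D" "Q n a b" for n a b
  proof -
    obtain l r s where lr: "(l, r) \<in> set R" "c n = subst s l" "c (Suc n) = subst s r"
      using run(2)[of n] by (auto simp: rewrite_step_def)
    let ?J = "I\<lparr>vint := asg a b s\<rparr>"
    have "tval ?J q = tval I (subst s q)" if "tvars q \<subseteq> {2..<k}" for q
      by (rule tval_vint_cong) (use that in \<open>auto simp: asg_def\<close>)
    then have tv: "tval ?J l = tval I (c n)" "tval ?J r = tval I (c (Suc n))"
      using R[OF lr(1)] lr(2,3) by auto
    have "fval ?J (rule_fm (l, r)) \<le> v"
      using le[OF that(1,2), of s] lr(1) by (auto simp: matrix_fm_def fval_disj_le_iff)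
    then show ?thesis
      using that \<open>v < 1\<close> midD[OF that(1,2)] run_ge tval_in[OF I, of "c (Suc n)"]
      by (auto simp: rule_fm_def tv asg_def Q_def mid_def split: if_splits)
  qed
  let ?a = "fint I 0 []" and ?b = "fint I 1 []"
  have ab: "?a \<in> ?D" "?b \<in> ?D" using I by (auto simp: based_on_def)
  \<comment> \<open>\<open>t\<close> may contain variables here, so the instance is taken at
    \<open>vint I\<close> itself, where \<open>t\<close> has the value of
    \<open>c 0\<close>.\<close>
  have "fval I (Neg (Run pt_lo pt_hi t)) \<le> v"
  proof -
    have "fval (I\<lparr>vint := vint I\<rparr>) (matrix_fm R t) \<le> v"
      unfolding v_def run_fm_def by (rule fval_exs_ge[OF V01 I]) (auto simp: vint)
    then show ?thesis by (simp add: matrix_fm_def)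
  qed
  then have "Q 0 ?a ?b"
    using \<open>v < 1\<close> run_ge[OF ab, of "tval I t"] tval_in[OF I, of t]
    by (auto simp: Q_def run(1) split: if_splits)
  with countable_closed_no_dense_bisection[OF clV V(2), of ?D val mid Q ?a ?b]
  show False using valV midD lt split ab by blast
qed

text \<open>Places point terms on the grid from 0 to \<open>M\<close>. The domain will consist of
  all terms, so those that are not points get the default 0.\<close>

function (sequential) pt_index :: "nat \<Rightarrow> tm \<Rightarrow> nat" where
  "pt_index M (Fn i [a, b]) = (if i = 0 then (pt_index M a + pt_index M b) div 2 else 0)"
| "pt_index M (Fn i []) = (if i = 1 then M else 0)"
| "pt_index M _ = 0"
  by pat_completeness auto
termination by (relation "measure (size \<circ> snd)") auto

lemma pt_index_le: "pt_index M t \<le> M"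
  by (induction M t rule: pt_index.induct) auto

text \<open>An infinite set may lack infinite increasing chains, but sorting a finite subset gives
  one of any finite length.\<close>

lemma infinite_strict_chain:
  fixes S :: "'a::linorder set"
  assumes "infinite S"
  obtains g :: "nat \<Rightarrow> 'a" where "\<And>i. i \<le> M \<Longrightarrow> g i \<in> S" "\<And>i j. i < j \<Longrightarrow> j \<le> M \<Longrightarrow> g i < g j"
proof -
  obtain T where T: "finite T" "card T = Suc M" "T \<subseteq> S"
    using infinite_arbitrarily_large[OF assms] by blast
  let ?xs = "sorted_list_of_set T"
  have len: "length ?xs = Suc M" using T by simp
  show thesis
  proof
    show "?xs ! i \<in> S" if "i \<le> M" for i
      using that T len nth_mem[of i ?xs] by auto
    show "?xs ! i < ?xs ! j" if "i < j" "j \<le> M" for i j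
      using sorted_wrt_nth_less[OF strict_sorted_list_of_set, of i j T] that len by simp
  qed
qed

text \<open>A rewriting process of length at most \<open>N\<close> is carried by a repeated bisection of a chain of
  \<open>2 ^ N + 1\<close> truth values below 1, hence in any infinite truth value set.\<close>

lemma run_fm_refutable:
  assumes V: "truth_value_set V" "infinite V"
    and t: "tvars t = {}" and bound: "\<And>s. \<not> (rewrite_step R ^^ Suc N) t s"
  shows "\<exists>I :: tm interp. based_on V I \<and> fval I (run_fm k R t) < 1"
proof -
  have V01: "V \<subseteq> {0..1}" "0 \<in> V" "1 \<in> V" using V by (auto simp: truth_value_set_def)
  define M :: nat where "M = 2 ^ N"
  \<comment> \<open>Leaving out 1 makes \<open>g M\<close> the uniform bound below 1.\<close>
  have "infinite (V - {1})" using V(2) by simp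
  then obtain g :: "nat \<Rightarrow> real" where g: "\<And>i. i \<le> M \<Longrightarrow> g i \<in> V - {1}"
    and gmono: "\<And>i j. i < j \<Longrightarrow> j \<le> M \<Longrightarrow> g i < g j"
    using infinite_strict_chain[of "V - {1}" M] by metis
  have g01: "0 \<le> g i" "g i \<le> g M" if "i \<le> M" for i
    using g[OF that] V01 gmono[of i M] that by (auto simp: le_less)
  have gM: "g M < 1" "0 \<le> g M" using g[of M] V01 by auto
  let ?ix = "pt_index M"
  \<comment> \<open>After \<open>n\<close> steps an interval has width \<open>2 ^ (N - n)\<close> on
    the grid, so it is proper, and its midpoint is exact as long as \<open>n < N\<close>.\<close>
  define runs where "runs a b c \<longleftrightarrow>
    (\<exists>n \<le> N. (rewrite_step R ^^ n) t c \<and> ?ix b = ?ix a + 2 ^ (N - n))" for a b c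
  define pr :: "nat \<Rightarrow> tm list \<Rightarrow> real" where "pr p ds = (case ds of [a] \<Rightarrow> g (?ix a)
    | [a, b, c] \<Rightarrow> if runs a b c then 1 else 0 | _ \<Rightarrow> 0)" for p ds
  define I where "I = \<lparr>domain = UNIV, fint = Fn, pint = pr, vint = Var\<rparr>"
  have I: "based_on V I"
    using V01 g pt_index_le[of M] by (auto simp: based_on_def I_def pr_def split: list.split)
  have halve: "runs a (pt_mid a b) d \<and> runs (pt_mid a b) b d"
    if run: "runs a b c" "rewrite_step R c d" for a b c d
  proof -
    obtain n where n: "n \<le> N" "(rewrite_step R ^^ n) t c" "?ix b = ?ix a + 2 ^ (N - n)"
      using run(1) by (auto simp: runs_def)
    have d: "(rewrite_step R ^^ Suc n) t d" using n(2) run(2) by auto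
    \<comment> \<open>A step from level \<open>N\<close> would reach \<open>Suc N\<close>, which
      \<open>bound\<close> excludes.\<close>
    then have "n \<noteq> N" using bound by metis
    then have "Suc n \<le> N" using n(1) by simp
    moreover have "(2::nat) ^ (N - n) = 2 * 2 ^ (N - Suc n)"
      using \<open>Suc n \<le> N\<close> by (metis Suc_diff_le diff_Suc_Suc power_Suc)
    ultimately show ?thesis
      unfolding runs_def using d n(3) by (auto intro!: exI[of _ "Suc n"] simp del: relpowp.simps)
  qed
  have "fval (I\<lparr>vint := e\<rparr>) (matrix_fm R t) \<le> g M" for e
  proof -
    let ?J = "I\<lparr>vint := e\<rparr>"
    have tv: "tval ?J q = subst e q" for q
      using tval_Herbrand[of ?J q] by (simp add: I_def)
    have start: "runs pt_lo pt_hi (subst e t)"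
      using subst_closed[OF t] by (auto simp: runs_def M_def intro!: exI[of _ 0])
    have rule: "fval ?J (rule_fm (l, r)) \<le> g M" if "(l, r) \<in> set R" for l r
    proof (cases "runs (e 0) (e 1) (subst e l)")
      case True
      moreover have "rewrite_step R (subst e l) (subst e r)"
        using that by (auto simp: rewrite_step_def)
      ultimately have "runs (e 0) (pt_mid (e 0) (e 1)) (subst e r)"
        "runs (pt_mid (e 0) (e 1)) (e 1) (subst e r)"
        using halve by blast+
      then show ?thesis using gM by (simp add: rule_fm_def tv) (simp add: I_def pr_def)
    next
      case False
      then show ?thesis using gM by (simp add: rule_fm_def tv) (simp add: I_def pr_def)
    qed
    have "g (?ix a) < g (?ix b)" if "runs a b c" for a b c
      using that pt_index_le[of M] by (intro gmono) (auto simp: runs_def)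
    then have order: "fval ?J order_fm \<le> g M"
      using gM g01[OF pt_index_le[of M]]
      by (simp add: order_fm_def tv) (auto simp: I_def pr_def min_le_iff_disj)
    show ?thesis
      using start rule order gM
      by (simp add: matrix_fm_def fval_disj_le_iff tv) (auto simp: I_def pr_def)
  qed
  then have "fval I (run_fm k R t) \<le> g M"
    unfolding run_fm_def by (intro fval_exs_le[OF I]) simp
  with I gM show ?thesis by (intro exI[of _ I]) simp
qed

section \<open>An abstract machine for the partial recursive functions\<close>

text \<open>The stack of pending work. \<open>KArg\<close> keeps the remaining argument programs,
  the input, the values found and the function waiting for them; \<open>KRec\<close> waits for the
  recursive value at \<open>n\<close>; \<open>KMu\<close> waits for the test of
  \<open>n\<close>.\<close>

datatype kont = Done
  | KArg "recf list" "nat list" "nat list" recf kont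
  | KRec recf nat "nat list" kont
  | KMu recf nat "nat list" kont

datatype conf = Eval recf "nat list" kont
  | Args "recf list" "nat list" "nat list" recf kont
  | Ret nat kont

text \<open>Only the final configurations have no successor: a program applied to a list of the
  wrong length loops. \<open>Args\<close> processes the list of argument programs in reverse order, so that
  the values are accumulated in the right one.\<close>

fun mstep :: "conf \<Rightarrow> conf option" where
  "mstep (Ret y Done) = None"
| "mstep (Eval Zero xs K) = Some (Ret 0 K)"
| "mstep (Eval Succ [] K) = Some (Eval Succ [] K)"
| "mstep (Eval Succ [n] K) = Some (Ret (Suc n) K)"
| "mstep (Eval Succ (a # b # xs) K) = Some (Eval Succ (a # b # xs) K)"
| "mstep (Eval (Proj i) [] K) = Some (Eval (Proj i) [] K)"
| "mstep (Eval (Proj 0) (x # xs) K) = Some (Ret x K)"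
| "mstep (Eval (Proj (Suc i)) (x # xs) K) = Some (Eval (Proj i) xs K)"
| "mstep (Eval (Comp f gs) xs K) = Some (Args (rev gs) xs [] f K)"
| "mstep (Args [] xs ys f K) = Some (Eval f ys K)"
| "mstep (Args (g # gs) xs ys f K) = Some (Eval g xs (KArg gs xs ys f K))"
| "mstep (Ret y (KArg gs xs ys f K)) = Some (Args gs xs (y # ys) f K)"
| "mstep (Eval (PrimRec f g) [] K) = Some (Eval (PrimRec f g) [] K)"
| "mstep (Eval (PrimRec f g) (0 # xs) K) = Some (Eval f xs K)"
| "mstep (Eval (PrimRec f g) (Suc n # xs) K) = Some (Eval (PrimRec f g) (n # xs) (KRec g n xs K))"
| "mstep (Ret r (KRec g n xs K)) = Some (Eval g (r # n # xs) K)"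
| "mstep (Eval (Mu f) xs K) = Some (Eval f (0 # xs) (KMu f 0 xs K))"
| "mstep (Ret 0 (KMu f n xs K)) = Some (Ret n K)"
| "mstep (Ret (Suc k) (KMu f n xs K)) = Some (Eval f (Suc n # xs) (KMu f (Suc n) xs K))"

section \<open>Agreement of machine runs with \<open>computes\<close>\<close>

definition mreach :: "conf \<Rightarrow> conf \<Rightarrow> bool" where
  "mreach = (\<lambda>c d. mstep c = Some d)\<^sup>*\<^sup>*"

lemma mreach_refl [simp]: "mreach c c"
  by (simp add: mreach_def)

lemma mreach_step: "mstep c = Some d \<Longrightarrow> mreach d e \<Longrightarrow> mreach c e"
  unfolding mreach_def by (rule converse_rtranclp_into_rtranclp)

lemma mreach_trans: "mreach c d \<Longrightarrow> mreach d e \<Longrightarrow> mreach c e"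
  unfolding mreach_def by (rule rtranclp_trans)

lemma mreach_Args:
  assumes "list_all2 (\<lambda>g y. \<forall>K. mreach (Eval g xs K) (Ret y K)) gs ys"
  shows "mreach (Args gs xs zs f K) (Eval f (rev ys @ zs) K)"
  using assms
proof (induction gs ys arbitrary: zs rule: list_all2_induct)
  case Nil
  show ?case by (auto intro: mreach_step)
next
  case (Cons g gs y ys)
  have "mreach (Ret y (KArg gs xs zs f K)) (Eval f (rev ys @ y # zs) K)"
    using Cons.IH[of "y # zs"] by (auto intro: mreach_step)
  then show ?case
    using Cons.hyps by (metis append.assoc append_Cons append_Nil mreach_step mreach_trans
      mstep.simps(11) rev.simps(2))
qed

text \<open>The search is started at an arbitrary \<open>n\<close>, so that induction on the
  distance \<open>d\<close> to the result goes through.\<close>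

lemma mreach_Mu:
  assumes "n + d = m" "\<forall>K. mreach (Eval f (m # xs) K) (Ret 0 K)"
    and "\<forall>i<m. \<exists>k. \<forall>K. mreach (Eval f (i # xs) K) (Ret (Suc k) K)"
  shows "mreach (Eval f (n # xs) (KMu f n xs K)) (Ret m K)"
  using assms
proof (induction d arbitrary: n)
  case 0
  then have "mreach (Eval f (n # xs) (KMu f n xs K)) (Ret 0 (KMu f n xs K))" by simp
  moreover have "mreach (Ret 0 (KMu f n xs K)) (Ret n K)" by (auto intro: mreach_step)
  ultimately show ?case using 0 by (auto intro: mreach_trans)
next
  case (Suc d)
  then have "n < m" by simp
  then obtain k where "mreach (Eval f (n # xs) (KMu f n xs K)) (Ret (Suc k) (KMu f n xs K))"
    using Suc.prems(3) by blast
  moreover have "mreach (Ret (Suc k) (KMu f n xs K)) (Ret m K)"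
    using Suc.IH[of "Suc n"] Suc.prems by (auto intro: mreach_step)
  ultimately show ?case by (rule mreach_trans)
qed

lemma computes_mreach: "computes p xs y \<Longrightarrow> mreach (Eval p xs K) (Ret y K)"
proof (induction arbitrary: K rule: computes.induct)
  case (proj i xs)
  then show ?case
  proof (induction i arbitrary: xs)
    case 0
    then show ?case by (cases xs) (auto intro: mreach_step)
  next
    case (Suc i)
    then show ?case by (cases xs) (auto intro: mreach_step)
  qed
next
  case (comp xs gs ys f z)
  have "list_all2 (\<lambda>g y. \<forall>K. mreach (Eval g xs K) (Ret y K)) (rev gs) (rev ys)"
    using comp.IH(1) by (auto elim: list_all2_mono)
  then have "mreach (Args (rev gs) xs [] f K) (Eval f ys K)"
    using mreach_Args[of xs "rev gs" "rev ys" "[]"] by simp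
  with comp.IH(2) show ?case by (metis mreach_step mreach_trans mstep.simps(9))
next
  case (rec_Suc f g n xs r y)
  have "mreach (Ret r (KRec g n xs K)) (Ret y K)"
    using rec_Suc.IH(2) by (auto intro: mreach_step)
  with rec_Suc.IH(1) show ?case by (metis mreach_step mreach_trans mstep.simps(15))
next
  case (mu f n xs)
  have "mreach (Eval f (0 # xs) (KMu f 0 xs K)) (Ret n K)"
    by (rule mreach_Mu[of 0 n]) (use mu.IH in \<open>simp_all, blast\<close>)
  then show ?case by (auto intro: mreach_step)
qed (auto intro: mreach_step)

text \<open>Expresses through \<open>computes\<close> that the pending work can be completed once
  \<open>y\<close> is returned. In the \<open>KMu\<close> case \<open>m\<close> is the result of the
  whole search and \<open>y\<close> the outcome of testing \<open>n\<close>.\<close>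

primrec kont_halts :: "kont \<Rightarrow> nat \<Rightarrow> bool" where
  "kont_halts Done y = True"
| "kont_halts (KArg gs xs ys f K) y = (\<exists>us z. list_all2 (\<lambda>g. computes g xs) gs us \<and>
     computes f (rev us @ y # ys) z \<and> kont_halts K z)"
| "kont_halts (KRec g n xs K) y = (\<exists>z. computes g (y # n # xs) z \<and> kont_halts K z)"
| "kont_halts (KMu f n xs K) y = (\<exists>m\<ge>n. kont_halts K m \<and> (y = 0 \<longrightarrow> m = n) \<and>
     (y > 0 \<longrightarrow> m > n \<and> computes f (m # xs) 0 \<and>
       (\<forall>i. n < i \<and> i < m \<longrightarrow> (\<exists>k. computes f (i # xs) (Suc k)))))"

primrec conf_halts :: "conf \<Rightarrow> bool" where
  "conf_halts (Eval p xs K) = (\<exists>y. computes p xs y \<and> kont_halts K y)"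
| "conf_halts (Args gs xs ys f K) = (\<exists>us z. list_all2 (\<lambda>g. computes g xs) gs us \<and>
     computes f (rev us @ ys) z \<and> kont_halts K z)"
| "conf_halts (Ret y K) = kont_halts K y"

text \<open>Pulling \<open>conf_halts\<close> back along steps, from a final configuration to the
  initial one, shows that a terminating run stems from a derivation of
  \<open>computes\<close>.\<close>

lemma conf_halts_mstep: "mstep c = Some d \<Longrightarrow> conf_halts d \<Longrightarrow> conf_halts c"
proof (induction c rule: mstep.induct)
  case (9 f gs xs K)
  then obtain us z where us: "list_all2 (\<lambda>g. computes g xs) (rev gs) us"
    and z: "computes f (rev us) z" "kont_halts K z" by auto
  from us have "list_all2 (\<lambda>g. computes g xs) gs (rev us)"
    by (metis list_all2_rev rev_rev_ident)
  with z show ?case by (auto intro: computes.comp)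
next
  case (8 i x xs K)
  then obtain y where "computes (Proj i) xs y" "kont_halts K y" by auto
  moreover from this have "i < length xs" "y = xs ! i" by (auto elim: computes.cases)
  ultimately show ?case using computes.proj[of "Suc i" "x # xs"] by auto
next
  case (11 g gs xs ys f K)
  then obtain y us z where "computes g xs y" "list_all2 (\<lambda>g. computes g xs) gs us"
    "computes f (rev us @ y # ys) z" "kont_halts K z" by auto
  then show ?case by (auto intro!: exI[of _ "y # us"])
next
  case (14 f g xs K)
  then show ?case by (metis computes.rec_0 conf_halts.simps(1) mstep.simps(14) option.inject)
next
  case (15 f g n xs K)
  then show ?case by simp (metis computes.rec_Suc conf_halts.simps(1) kont_halts.simps(3))
next
  case (17 f xs K)
  then obtain y m where y: "computes f (0 # xs) y" and m: "kont_halts K m" "y = 0 \<longrightarrow> m = 0"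
      "y > 0 \<longrightarrow> m > 0 \<and> computes f (m # xs) 0 \<and>
        (\<forall>i. 0 < i \<and> i < m \<longrightarrow> (\<exists>k. computes f (i # xs) (Suc k)))"
    by auto
  have "computes f (m # xs) 0" using y m by (cases "y = 0") auto
  moreover have "\<exists>k. computes f (i # xs) (Suc k)" if "i < m" for i
    using that y m by (cases "i = 0"; cases y) auto
  ultimately show ?case using m(1) by (auto intro: computes.mu)
next
  case (19 k f n xs K)
  then obtain y m where y: "computes f (Suc n # xs) y" and m: "kont_halts K m" "m \<ge> Suc n"
      "y = 0 \<longrightarrow> m = Suc n" "y > 0 \<longrightarrow> m > Suc n \<and> computes f (m # xs) 0 \<and>
        (\<forall>i. Suc n < i \<and> i < m \<longrightarrow> (\<exists>k. computes f (i # xs) (Suc k)))"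
    by auto
  have "computes f (m # xs) 0" using y m by (cases "y = 0") auto
  moreover have "\<exists>k. computes f (i # xs) (Suc k)" if "n < i" "i < m" for i
    using that y m by (cases "i = Suc n"; cases y) auto
  ultimately show ?case using m by (simp, intro exI[of _ m]) auto
qed (auto intro: computes.intros)

lemma mstep_None_halts: "mstep c = None \<Longrightarrow> conf_halts c"
  by (cases c rule: mstep.cases) auto

primrec mrun :: "conf \<Rightarrow> nat \<Rightarrow> conf option" where
  "mrun c 0 = Some c"
| "mrun c (Suc n) = Option.bind (mrun c n) mstep"

lemma mreach_mrun: "mreach c d \<Longrightarrow> \<exists>n. mrun c n = Some d"
  unfolding mreach_def
proof (induction rule: rtranclp_induct)
  case base
  have "mrun c 0 = Some c" by simp
  then show ?case ..
next
  case (step d e)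
  then obtain n where "mrun c n = Some d" by blast
  then have "mrun c (Suc n) = Some e" using step by simp
  then show ?case ..
qed

lemma conf_halts_mrun: "mrun c n = Some d \<Longrightarrow> conf_halts d \<Longrightarrow> conf_halts c"
  by (induction n arbitrary: d) (auto simp: bind_eq_Some_conv dest: conf_halts_mstep)

lemma mrun_terminates_iff:
  "(\<exists>n. mrun (Eval p xs Done) n = None) \<longleftrightarrow> (\<exists>y. computes p xs y)"
proof
  assume "\<exists>y. computes p xs y"
  then obtain y n where "mrun (Eval p xs Done) n = Some (Ret y Done)"
    using computes_mreach mreach_mrun by metis
  then have "mrun (Eval p xs Done) (Suc n) = None" by simp
  then show "\<exists>n. mrun (Eval p xs Done) n = None" ..
next
  assume "\<exists>n. mrun (Eval p xs Done) n = None"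
  then obtain n where n: "mrun (Eval p xs Done) n = None" by blast
  \<comment> \<open>The last configuration before \<open>None\<close> has no successor.\<close>
  have "\<exists>n d. mrun (Eval p xs Done) n = Some d \<and> mstep d = None"
  proof (use n in \<open>induction n\<close>)
    case (Suc n)
    then show ?case by (cases "mrun (Eval p xs Done) n") auto
  qed simp
  then have "conf_halts (Eval p xs Done)"
    using conf_halts_mrun mstep_None_halts by blast
  then show "\<exists>y. computes p xs y" by auto
qed


section \<open>The machine as a rewriting system\<close>

abbreviation "zero_tm \<equiv> Fn 2 []"
abbreviation "suc_tm t \<equiv> Fn 0 [t]"
abbreviation "nil_tm \<equiv> Fn 3 []"
abbreviation "cons_tm s t \<equiv> Fn 1 [s, t]"
abbreviation "Zero_tm \<equiv> Fn 4 []"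
abbreviation "Succ_tm \<equiv> Fn 5 []"
abbreviation "Proj_tm i \<equiv> Fn 1 [i]"
abbreviation "Comp_tm f gs \<equiv> Fn 2 [f, gs]"
abbreviation "PrimRec_tm f g \<equiv> Fn 3 [f, g]"
abbreviation "Mu_tm f \<equiv> Fn 2 [f]"
abbreviation "Done_tm \<equiv> Fn 6 []"
abbreviation "KArg_tm gs xs ys f K \<equiv> Fn 0 [gs, xs, ys, f, K]"
abbreviation "KRec_tm g n xs K \<equiv> Fn 0 [g, n, xs, K]"
abbreviation "KMu_tm f n xs K \<equiv> Fn 1 [f, n, xs, K]"
abbreviation "Eval_tm p xs K \<equiv> Fn 0 [p, xs, K]"
abbreviation "Args_tm gs xs ys f K \<equiv> Fn 1 [gs, xs, ys, f, K]"
abbreviation "Ret_tm y K \<equiv> Fn 4 [y, K]"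

primrec num_tm :: "nat \<Rightarrow> tm" where
  "num_tm 0 = zero_tm"
| "num_tm (Suc n) = suc_tm (num_tm n)"

primrec list_tm :: "tm list \<Rightarrow> tm" where
  "list_tm [] = nil_tm"
| "list_tm (t # ts) = cons_tm t (list_tm ts)"

text \<open>A single root rewrite cannot reverse a list of arbitrary length, so \<open>Comp\<close>
  stores its argument programs reversed, matching the \<open>rev gs\<close> in
  \<open>mstep\<close>.\<close>

primrec recf_tm :: "recf \<Rightarrow> tm" where
  "recf_tm Zero = Zero_tm"
| "recf_tm Succ = Succ_tm"
| "recf_tm (Proj i) = Proj_tm (num_tm i)"
| "recf_tm (Comp f gs) = Comp_tm (recf_tm f) (list_tm (rev (map recf_tm gs)))"
| "recf_tm (PrimRec f g) = PrimRec_tm (recf_tm f) (recf_tm g)"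
| "recf_tm (Mu f) = Mu_tm (recf_tm f)"

abbreviation nums_tm :: "nat list \<Rightarrow> tm" where
  "nums_tm xs \<equiv> list_tm (map num_tm xs)"

abbreviation recfs_tm :: "recf list \<Rightarrow> tm" where
  "recfs_tm fs \<equiv> list_tm (map recf_tm fs)"

primrec kont_tm :: "kont \<Rightarrow> tm" where
  "kont_tm Done = Done_tm"
| "kont_tm (KArg gs xs ys f K) =
     KArg_tm (recfs_tm gs) (nums_tm xs) (nums_tm ys) (recf_tm f) (kont_tm K)"
| "kont_tm (KRec g n xs K) = KRec_tm (recf_tm g) (num_tm n) (nums_tm xs) (kont_tm K)"
| "kont_tm (KMu f n xs K) = KMu_tm (recf_tm f) (num_tm n) (nums_tm xs) (kont_tm K)"

primrec conf_tm :: "conf \<Rightarrow> tm" where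
  "conf_tm (Eval p xs K) = Eval_tm (recf_tm p) (nums_tm xs) (kont_tm K)"
| "conf_tm (Args gs xs ys f K) =
     Args_tm (recfs_tm gs) (nums_tm xs) (nums_tm ys) (recf_tm f) (kont_tm K)"
| "conf_tm (Ret y K) = Ret_tm (num_tm y) (kont_tm K)"

text \<open>One entry for each equation of \<open>mstep\<close> with a successor. Parameters instead
  of variables let the same list give the rules and their instances.\<close>

definition rule_instances :: "tm \<Rightarrow> tm \<Rightarrow> tm \<Rightarrow> tm \<Rightarrow> tm \<Rightarrow> tm \<Rightarrow> tm \<Rightarrow> tm \<Rightarrow> (tm \<times> tm) list" where
  "rule_instances f g n a b xs ys K =
    [(Eval_tm Zero_tm xs K, Ret_tm zero_tm K),
     (Eval_tm Succ_tm nil_tm K, Eval_tm Succ_tm nil_tm K),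
     (Eval_tm Succ_tm (cons_tm n nil_tm) K, Ret_tm (suc_tm n) K),
     (Eval_tm Succ_tm (cons_tm a (cons_tm b xs)) K, Eval_tm Succ_tm (cons_tm a (cons_tm b xs)) K),
     (Eval_tm (Proj_tm n) nil_tm K, Eval_tm (Proj_tm n) nil_tm K),
     (Eval_tm (Proj_tm zero_tm) (cons_tm a xs) K, Ret_tm a K),
     (Eval_tm (Proj_tm (suc_tm n)) (cons_tm a xs) K, Eval_tm (Proj_tm n) xs K),
     (Eval_tm (Comp_tm f g) xs K, Args_tm g xs nil_tm f K),
     (Args_tm nil_tm xs ys f K, Eval_tm f ys K),
     (Args_tm (cons_tm a g) xs ys f K, Eval_tm a xs (KArg_tm g xs ys f K)),
     (Ret_tm a (KArg_tm g xs ys f K), Args_tm g xs (cons_tm a ys) f K),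
     (Eval_tm (PrimRec_tm f g) nil_tm K, Eval_tm (PrimRec_tm f g) nil_tm K),
     (Eval_tm (PrimRec_tm f g) (cons_tm zero_tm xs) K, Eval_tm f xs K),
     (Eval_tm (PrimRec_tm f g) (cons_tm (suc_tm n) xs) K,
      Eval_tm (PrimRec_tm f g) (cons_tm n xs) (KRec_tm g n xs K)),
     (Ret_tm a (KRec_tm g n xs K), Eval_tm g (cons_tm a (cons_tm n xs)) K),
     (Eval_tm (Mu_tm f) xs K, Eval_tm f (cons_tm zero_tm xs) (KMu_tm f zero_tm xs K)),
     (Ret_tm zero_tm (KMu_tm f n xs K), Ret_tm n K),
     (Ret_tm (suc_tm a) (KMu_tm f n xs K),
      Eval_tm f (cons_tm (suc_tm n) xs) (KMu_tm f (suc_tm n) xs K))]"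

text \<open>The variables 0 and 1 are taken by the endpoints of the interval in \<open>rule_fm\<close>.\<close>

definition machine_rules :: "(tm \<times> tm) list" where
  "machine_rules = rule_instances (Var 2) (Var 3) (Var 4) (Var 5) (Var 6) (Var 7) (Var 8) (Var 9)"

lemma tvars_machine_rules: "(l, r) \<in> set machine_rules \<Longrightarrow> tvars l \<union> tvars r \<subseteq> {2..<10}"
  by (auto simp: machine_rules_def rule_instances_def)

lemma rewrite_machine_rules_iff:
  "rewrite_step machine_rules s t \<longleftrightarrow>
    (\<exists>f g n a b xs ys K. (s, t) \<in> set (rule_instances f g n a b xs ys K))"
proof -
  have "map (map_prod (subst e) (subst e)) machine_rules =
      rule_instances (e 2) (e 3) (e 4) (e 5) (e 6) (e 7) (e 8) (e 9)" for e
    by (simp add: machine_rules_def rule_instances_def)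
  then have inst: "map_prod (subst e) (subst e) ` set machine_rules =
      set (rule_instances (e 2) (e 3) (e 4) (e 5) (e 6) (e 7) (e 8) (e 9))" for e
    by (metis list.set_map)
  have "rewrite_step machine_rules s t \<longleftrightarrow>
      (\<exists>e. (s, t) \<in> map_prod (subst e) (subst e) ` set machine_rules)"
    by (force simp: rewrite_step_def)
  also have "\<dots> \<longleftrightarrow> (\<exists>f g n a b xs ys K. (s, t) \<in> set (rule_instances f g n a b xs ys K))"
  proof
    assume "\<exists>f g n a b xs ys K. (s, t) \<in> set (rule_instances f g n a b xs ys K)"
    then obtain f g n a b xs ys K where "(s, t) \<in> set (rule_instances f g n a b xs ys K)"
      by blast
    \<comment> \<open>Variable 9 receives \<open>K\<close> as the default value of
      \<open>e\<close>.\<close>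
    then have "(s, t) \<in> map_prod (subst e) (subst e) ` set machine_rules"
      if "e = (\<lambda>_. K)(2 := f, 3 := g, 4 := n, 5 := a, 6 := b, 7 := xs, 8 := ys)" for e
      unfolding inst that by simp
    then show "\<exists>e. (s, t) \<in> map_prod (subst e) (subst e) ` set machine_rules" by blast
  qed (unfold inst, blast)
  finally show ?thesis .
qed

lemma tvars_conf_tm: "tvars (conf_tm c) = {}"
proof -
  have num: "tvars (num_tm n) = {}" for n by (induction n) auto
  have list: "tvars (list_tm ts) = (\<Union>t \<in> set ts. tvars t)" for ts by (induction ts) auto
  have recf: "tvars (recf_tm p) = {}" for p by (induction p) (auto simp: num list)
  have "tvars (kont_tm K) = {}" for K by (induction K) (auto simp: num list recf)
  then show ?thesis by (cases c) (auto simp: num list recf)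
qed

lemma rewrite_conf_tm_imp:
  "rewrite_step machine_rules (conf_tm c) t \<Longrightarrow> \<exists>d. mstep c = Some d \<and> t = conf_tm d"
  by (cases c rule: mstep.cases)
    (auto simp: rewrite_machine_rules_iff rule_instances_def rev_map)

lemma mstep_rewrite:
  assumes "mstep c = Some d"
  shows "rewrite_step machine_rules (conf_tm c) (conf_tm d)"
proof -
  have "mstep c \<noteq> None \<Longrightarrow> rewrite_step machine_rules (conf_tm c) (conf_tm (the (mstep c)))"
    by (cases c rule: mstep.cases)
      (simp_all add: rewrite_machine_rules_iff rule_instances_def rev_map[symmetric])
  then show ?thesis using assms by simp
qed

lemma relpowp_conf_tm:
  "(rewrite_step machine_rules ^^ n) (conf_tm c) t \<Longrightarrow> \<exists>d. mrun c n = Some d \<and> t = conf_tm d"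
proof (induction n arbitrary: t)
  case (Suc n)
  then show ?case using rewrite_conf_tm_imp by fastforce
qed simp

text \<open>Defined for every term \<open>p\<close>, program or not, so that the diagonal map is
  total on terms. The 10 quantifiers cover the variables 0 to 9.\<close>

definition nonhalting_fm :: "tm \<Rightarrow> nat \<Rightarrow> fm" where
  "nonhalting_fm p n = run_fm 10 machine_rules (Eval_tm p (nums_tm [n]) Done_tm)"

lemma nonhalting_fm_prenex_fragment_iff:
  assumes "infinite (UNIV :: 'u set)" "truth_value_set V" "countable V" "infinite V"
  shows "nonhalting_fm (recf_tm p) n \<in> prenex_fragment TYPE('u) V \<longleftrightarrow> \<not> (\<exists>y. computes p [n] y)"
proof -
  let ?c = "Eval p [n] Done"
  have eq: "nonhalting_fm (recf_tm p) n = run_fm 10 machine_rules (conf_tm ?c)"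
    by (simp add: nonhalting_fm_def)
  show ?thesis
  proof
    assume L: "nonhalting_fm (recf_tm p) n \<in> prenex_fragment TYPE('u) V"
    show "\<not> (\<exists>y. computes p [n] y)"
    proof
      assume "\<exists>y. computes p [n] y"
      then obtain N where N: "mrun ?c N = None"
        using mrun_terminates_iff[of p "[n]"] by blast
      then have "mrun ?c (Suc N) = None" by simp
      then have "\<not> (rewrite_step machine_rules ^^ Suc N) (conf_tm ?c) s" for s
        using relpowp_conf_tm[of "Suc N" ?c s] by auto
      then obtain I :: "tm interp" where "based_on V I" "fval I (nonhalting_fm (recf_tm p) n) < 1"
        using run_fm_refutable[OF assms(2,4) tvars_conf_tm[of ?c]] unfolding eq by blast
      \<comment> \<open>The countermodel lives on \<open>tm\<close>; soundness carries validity over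
        from \<open>'u\<close>.\<close>
      with goedel_logic_sound[OF assms(1,2), of _ I] L show False
        by (force simp: prenex_fragment_def)
    qed
  next
    assume "\<not> (\<exists>y. computes p [n] y)"
    then have "\<exists>d. mrun ?c k = Some d" for k
      using mrun_terminates_iff[of p "[n]"] by auto
    then obtain c where c: "\<And>k. mrun ?c k = Some (c k)" by metis
    have "mstep (c k) = Some (c (Suc k))" for k
      using c[of k] c[of "Suc k"] by simp
    then have "fval I (nonhalting_fm (recf_tm p) n) = 1" if "based_on V I" for I :: "'u interp"
      unfolding eq using that c[of 0] assms
      by (intro run_fm_valid[where c = "conf_tm \<circ> c"] tvars_machine_rules) (auto simp: mstep_rewrite)
    then show "nonhalting_fm (recf_tm p) n \<in> prenex_fragment TYPE('u) V"
      by (simp add: prenex_fragment_def goedel_logic_def eq prenex_run_fm)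
  qed
qed


section \<open>Computability of the reduction\<close>

text \<open>The program has to be right only on lists of the form \<open>c a\<close>; for functions
  on terms this means on codes, so nothing is decoded.\<close>

definition computable_from :: "('a \<Rightarrow> nat list) \<Rightarrow> ('a \<Rightarrow> nat) \<Rightarrow> bool" where
  "computable_from c g \<longleftrightarrow> (\<exists>r. \<forall>a. computes r (c a) (g a))"

lemma computable_from_nth:
  "(\<And>a. i < length (c a)) \<Longrightarrow> computable_from c (\<lambda>a. c a ! i)"
  unfolding computable_from_def by (intro exI[of _ "Proj i"]) (auto intro: computes.proj)

lemma computable_from_self: "computable_from (\<lambda>a. [c a]) c"
  using computable_from_nth[of 0 "\<lambda>a. [c a]"] by simp

lemma computable_from_comp:
  assumes "computable_from c g" "computable_from (\<lambda>n. [n]) h"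
  shows "computable_from c (\<lambda>a. h (g a))"
proof -
  obtain r s where "\<forall>a. computes r (c a) (g a)" "\<forall>n. computes s [n] (h n)"
    using assms unfolding computable_from_def by blast
  then have "\<forall>a. computes (Comp s [r]) (c a) (h (g a))"
    by (auto intro: computes.comp[where ys = "[_]"])
  then show ?thesis unfolding computable_from_def by blast
qed

lemma computable_from_comp2:
  assumes "computable_from c g" "computable_from c g'"
    and "computable_from (\<lambda>(m, n). [m, n]) (\<lambda>(m, n). h m n)"
  shows "computable_from c (\<lambda>a. h (g a) (g' a))"
proof -
  obtain r r' s where "\<forall>a. computes r (c a) (g a)" "\<forall>a. computes r' (c a) (g' a)"
    "\<forall>m n. computes s [m, n] (h m n)"
    using assms unfolding computable_from_def by (auto simp: split_paired_all)
  then have "\<forall>a. computes (Comp s [r, r']) (c a) (h (g a) (g' a))"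
    by (auto intro: computes.comp[where ys = "[_, _]"])
  then show ?thesis unfolding computable_from_def by blast
qed

lemma computable_from_Suc: "computable_from c g \<Longrightarrow> computable_from c (\<lambda>a. Suc (g a))"
  by (rule computable_from_comp) (auto simp: computable_from_def intro: computes.succ)

lemma computable_from_const: "computable_from c (\<lambda>_. k)"
proof (induction k)
  case 0
  show ?case unfolding computable_from_def by (blast intro: computes.zero)
qed (rule computable_from_Suc)

lemma computable_from_rec_nat:
  assumes "computable_from c f" "computable_from (\<lambda>(r, n, a). r # n # c a) (\<lambda>(r, n, a). h n r)"
  shows "computable_from (\<lambda>(n, a). n # c a) (\<lambda>(n, a). rec_nat (f a) h n)"
proof -
  obtain p q where p: "\<And>a. computes p (c a) (f a)"
    and q: "\<And>r n a. computes q (r # n # c a) (h n r)"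
    using assms unfolding computable_from_def by (auto simp: split_paired_all)
  have "computes (PrimRec p q) (n # c a) (rec_nat (f a) h n)" for n a
    by (induction n) (auto intro: computes.rec_0 computes.rec_Suc p q)
  then show ?thesis unfolding computable_from_def by auto
qed

lemma computable_from_add:
  assumes "computable_from c g" "computable_from c h"
  shows "computable_from c (\<lambda>a. g a + h a)"
proof (rule computable_from_comp2[OF assms])
  have "rec_nat n (\<lambda>_. Suc) m = m + n" for m n by (induction m) auto
  moreover have "computable_from (\<lambda>(r, n, a::nat). [r, n, a]) (\<lambda>(r, n, a). Suc r)"
    using computable_from_Suc[OF computable_from_nth[of 0 "\<lambda>(r, n, a::nat). [r, n, a]"]]
    by (simp add: case_prod_unfold)
  ultimately show "computable_from (\<lambda>(m, n). [m, n]) (\<lambda>(m, n). m + n)"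
    using computable_from_rec_nat[OF computable_from_self[of id], of "\<lambda>_. Suc"] by simp
qed

text \<open>Serves the pairing function: \<open>prod_encode (m, n)\<close> is
  \<open>triangle (m + n) + m\<close>.\<close>

lemma computable_triangle: "computable_from (\<lambda>n. [n]) triangle"
proof -
  have "rec_nat 0 (\<lambda>n r. Suc (r + n)) n = triangle n" for n by (induction n) auto
  moreover have "computable_from (\<lambda>(r, n, _::unit). [r, n]) (\<lambda>(r, n, _). Suc (r + n))"
    using computable_from_nth[of 0 "\<lambda>(r, n, _::unit). [r, n]"]
      computable_from_nth[of 1 "\<lambda>(r, n, _::unit). [r, n]"]
    by (auto simp: case_prod_unfold intro: computable_from_Suc computable_from_add)
  ultimately have "computable_from (\<lambda>(n, _::unit). [n]) (\<lambda>(n, _). triangle n)"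
    using computable_from_rec_nat[OF computable_from_const[of "\<lambda>_::unit. []"], of "\<lambda>n r. Suc (r + n)" 0] by simp
  then show ?thesis by (simp add: computable_from_def)
qed

lemma computable_from_prod_encode:
  assumes "computable_from c g" "computable_from c h"
  shows "computable_from c (\<lambda>a. prod_encode (g a, h a))"
  using computable_from_add[OF
      computable_from_comp[OF computable_from_add[OF assms] computable_triangle] assms(1)]
  by (simp add: prod_encode_def)

lemmas computable_from_intros =
  computable_from_self computable_from_Suc computable_from_const computable_from_prod_encode

lemma computable_num_tm: "computable_from (\<lambda>n. [n]) (\<lambda>n. tm_code (num_tm n))"
proof -
  \<comment> \<open>\<open>Suc (prod_encode (c, 0))\<close> encodes the one-element list of
    \<open>c\<close>.\<close>
  let ?h = "\<lambda>_ c. prod_encode (1, prod_encode (0, Suc (prod_encode (c, 0))))"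
  have "rec_nat (tm_code zero_tm) ?h n = tm_code (num_tm n)" for n by (induction n) auto
  moreover have "computable_from (\<lambda>(r, n, _::unit). [r, n]) (\<lambda>(r, n, _). ?h n r)"
    using computable_from_nth[of 0 "\<lambda>(r, n, _::unit). [r, n]"]
    by (auto simp: case_prod_unfold intro!: computable_from_intros)
  ultimately have "computable_from (\<lambda>(n, _::unit). [n]) (\<lambda>(n, _). tm_code (num_tm n))"
    using computable_from_rec_nat[OF computable_from_const[of "\<lambda>_::unit. []"], of ?h "tm_code zero_tm"] by simp
  then show ?thesis by (simp add: computable_from_def)
qed

lemma computable_fm_code_exs:
  "computable_from c (\<lambda>a. fm_code (B a)) \<Longrightarrow> computable_from c (\<lambda>a. fm_code (exs k (B a)))"
  by (induction k) (auto intro!: computable_from_intros)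

text \<open>Only the codes of \<open>t\<close> and of the numeral for \<open>tm_code t\<close> vary;
  all else is a fixed nesting of pairs.\<close>

lemma computable_nonhalting_fm:
  "computable_from (\<lambda>t. [tm_code t]) (\<lambda>t. fm_code (nonhalting_fm t (tm_code t)))"
  using computable_from_comp[OF computable_from_self computable_num_tm, of "tm_code"]
  by (auto simp: nonhalting_fm_def run_fm_def matrix_fm_def
      intro!: computable_fm_code_exs computable_from_intros)

section \<open>The diagonal argument\<close>

theorem theorem6p2:
  fixes V :: "real set"
  assumes "infinite (UNIV :: 'u set)"
    and "truth_value_set V"
    and "countable V" and "infinite V"
  shows "\<not> axiomatizable (prenex_fragment TYPE('u) V)"
proof
  let ?S = "prenex_fragment TYPE('u) V"
  let ?A = "\<lambda>t. nonhalting_fm t (tm_code t)"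
  assume "axiomatizable ?S"
  then obtain r where r: "fm_code ` ?S = {n. \<exists>y. computes r [n] y}"
    by (auto simp: axiomatizable_def recursively_enumerable_def)
  obtain F where F: "\<And>t. computes F [tm_code t] (fm_code (?A t))"
    using computable_nonhalting_fm unfolding computable_from_def by blast
  \<comment> \<open>On the code of \<open>t\<close>, \<open>p\<close> semi-decides whether
    \<open>?A t\<close> is valid; at its own term that formula says that \<open>p\<close> does not
    halt there.\<close>
  define p where "p = Comp r [F]"
  let ?t = "recf_tm p"
  have "?A ?t \<in> ?S \<longleftrightarrow> fm_code (?A ?t) \<in> fm_code ` ?S"
    by (simp add: inj_image_mem_iff[OF inj_fm_code])
  also have "\<dots> \<longleftrightarrow> (\<exists>y. computes r [fm_code (?A ?t)] y)"
    unfolding r by simp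
  also have "\<dots> \<longleftrightarrow> (\<exists>y. computes p [tm_code ?t] y)"
  proof
    assume "\<exists>y. computes r [fm_code (?A ?t)] y"
    then show "\<exists>y. computes p [tm_code ?t] y"
      using F[of ?t] by (auto simp: p_def intro: computes.comp[where ys = "[_]"])
  next
    assume "\<exists>y. computes p [tm_code ?t] y"
    then obtain ys y where "list_all2 (\<lambda>g. computes g [tm_code ?t]) [F] ys" "computes r ys y"
      unfolding p_def by (auto elim: computes.cases)
    moreover from this have "ys = [fm_code (?A ?t)]"
      using computes_fun[OF F[of ?t]] by (auto simp: list_all2_Cons1)
    ultimately show "\<exists>y. computes r [fm_code (?A ?t)] y" by blast
  qed
  also have "\<dots> \<longleftrightarrow> ?A ?t \<notin> ?S"
    using nonhalting_fm_prenex_fragment_iff[OF assms, of p "tm_code ?t"] by blast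
  finally show False by simp
qed

end
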